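(* Let $n\ge1$ be odd, $\varepsilon\ge0$, $U$ a unitary on a finite-dimensional Hilbert space, $\widetilde\Pi,\Pi$ orthogonal projectors, and $W\colon\mathrm{img}\,\Pi\to\mathrm{img}\,\widetilde\Pi$ an isometry such that for all unit vectors $|\psi\rangle\in\mathrm{img}\,\Pi$ $$\left\|\sin\left(\tfrac{\pi}{2n}\right)W|\psi\rangle-\widetilde\Pi U|\psi\rangle\right\|\le\varepsilon.$$ Then there exist $\Phi\in\mathbb{R}^n$ and a sign $s\in\{+1,-1\}$ such that $\tilde U:=s\,U_\Phi$ satisfies, for all unit vectors $|\psi\rangle\in\mathrm{img}\,\Pi$, $$\left\|W|\psi\rangle-\widetilde\Pi\tilde U|\psi\rangle\right\|\le 2n\varepsilon.$$
   Context: For odd $n$ and $\Phi=(\phi_1,\ldots,\phi_n)$: $U_\Phi:=e^{i\phi_1(2\widetilde\Pi-I)}U\prod_{j=1}^{(n-1)/2}\left(e^{i\phi_{2j}(2\Pi-I)}U^\dagger e^{i\phi_{2j+1}(2\widetilde\Pi-I)}U\right)$ (product written left to right). *)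

theory Defs
  imports "HOL-Analysis.Analysis"
begin

text \<open>Finite-dimensional Hilbert space: complex^'n with the Euclidean norm;
operators: complex matrices complex^'n^'n.\<close>

type_synonym 'n cmat = "complex^'n^'n"

definition cadj :: "'n::finite cmat \<Rightarrow> 'n cmat" where
  "cadj A = (\<chi> i j. cnj (A $ j $ i))"

definition csmult :: "complex \<Rightarrow> 'n::finite cmat \<Rightarrow> 'n cmat" where
  "csmult c A = (\<chi> i j. c * A $ i $ j)"

definition unitary :: "'n::finite cmat \<Rightarrow> bool" where
  "unitary U \<longleftrightarrow> cadj U ** U = mat 1 \<and> U ** cadj U = mat 1"

definition orth_proj :: "'n::finite cmat \<Rightarrow> bool" where
  "orth_proj P \<longleftrightarrow> P ** P = P \<and> cadj P = P"

definition img :: "'n::finite cmat \<Rightarrow> (complex^'n) set" where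
  "img P = range (\<lambda>x. P *v x)"

definition mpow :: "'n::finite cmat \<Rightarrow> nat \<Rightarrow> 'n cmat" where
  "mpow A k = ((\<lambda>B. A ** B) ^^ k) (mat 1)"

text \<open>Matrix exponential as the exponential power series.\<close>
definition mexp :: "'n::finite cmat \<Rightarrow> 'n cmat" where
  "mexp A = (\<Sum>k. (1 / fact k) *\<^sub>R mpow A k)"

text \<open>e^{i phi (2P - I)}\<close>
definition refl_phase :: "real \<Rightarrow> 'n::finite cmat \<Rightarrow> 'n cmat" where
  "refl_phase \<phi> P = mexp (csmult (\<i> * complex_of_real \<phi>) (2 *\<^sub>R P - mat 1))"

text \<open>Partial product: e^{i phi_1 (2Pt-I)} U times the first m factors
  (e^{i phi_{2j}(2P-I)} U^dagger e^{i phi_{2j+1}(2Pt-I)} U), j = 1..m, left to right.\<close>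
fun Uphi_aux :: "'n::finite cmat \<Rightarrow> 'n cmat \<Rightarrow> 'n cmat \<Rightarrow> (nat \<Rightarrow> real) \<Rightarrow> nat \<Rightarrow> 'n cmat" where
  "Uphi_aux Pt P U \<phi> 0 = refl_phase (\<phi> 1) Pt ** U"
| "Uphi_aux Pt P U \<phi> (Suc m) = Uphi_aux Pt P U \<phi> m **
     (refl_phase (\<phi> (2 * Suc m)) P ** cadj U ** refl_phase (\<phi> (2 * Suc m + 1)) Pt ** U)"

text \<open>U_Phi for odd n, with Phi = (phi 1, ..., phi n).\<close>
definition Uphi :: "'n::finite cmat \<Rightarrow> 'n cmat \<Rightarrow> 'n cmat \<Rightarrow> nat \<Rightarrow> (nat \<Rightarrow> real) \<Rightarrow> 'n cmat" where
  "Uphi Pt P U n \<phi> = Uphi_aux Pt P U \<phi> ((n - 1) div 2)"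

end

theory Submission
  imports Defs
begin

text \<open>Take \<open>\<Phi> = (0, \<pi>/2, \<dots>, \<pi>/2)\<close> and sign \<open>+1\<close>. For \<open>n = 2k + 1\<close> this makes \<open>U\<^sub>\<Phi> = U G\<^sup>k\<close>
  with the Grover iterate \<open>G = - (2\<Pi> - I) U\<^sup>\<dagger> (2\<Pi>\<^sup>~ - I) U\<close>. Put \<open>\<theta> = \<pi>/(2n)\<close>, fix a unit
  vector \<open>\<psi>\<close> in the image of \<open>\<Pi>\<close> and let \<open>y = U\<^sup>\<dagger> W \<psi>\<close>. The hypothesis says
  \<open>\<Pi>\<^sup>~ U \<psi> \<approx> sin \<theta> \<cdot> U y\<close>, and its adjoint form says \<open>\<Pi> y \<approx> sin \<theta> \<cdot> \<psi>\<close>, both up to \<open>\<epsilon>\<close>.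
  If both were exact, \<open>G\<close> would act on the plane spanned by \<open>\<psi>\<close> and \<open>y\<close> as a rotation by
  \<open>2\<theta>\<close>, carrying \<open>\<psi>\<close> to \<open>y\<close> in \<open>k\<close> steps, and then \<open>\<Pi>\<^sup>~ U G\<^sup>k \<psi> = \<Pi>\<^sup>~ W \<psi> = W \<psi>\<close>. In general
  each step deviates from the ideal rotation by at most \<open>4\<epsilon>\<close>, and because \<open>G\<close> is unitary
  these deviations only add up, giving \<open>4k\<epsilon> \<le> 2n\<epsilon>\<close>. For \<open>n = 1\<close> the claim is the hypothesis.\<close>

lemma csmult_mult_csmult: "csmult c (A::'n::finite cmat) ** csmult d B = csmult (c * d) (A ** B)"
  by (simp add: csmult_def matrix_matrix_mult_def vec_eq_iff sum_distrib_left mult_ac)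

lemma csmult_add_left: "csmult (a + b) (A::'n::finite cmat) = csmult a A + csmult b A"
  by (simp add: csmult_def vec_eq_iff distrib_right)

lemma scaleR_csmult: "r *\<^sub>R csmult c (A::'n::finite cmat) = csmult (r *\<^sub>R c) A"
  by (simp add: csmult_def vec_eq_iff)

lemma csmult_0 [simp]: "csmult 0 (A::'n::finite cmat) = 0"
  by (simp add: csmult_def vec_eq_iff)

lemma csmult_1 [simp]: "csmult 1 (A::'n::finite cmat) = A"
  by (simp add: csmult_def vec_eq_iff)

lemma bounded_linear_csmult: "bounded_linear (\<lambda>c. csmult c (A::'n::finite cmat))"
proof -
  have "linear (\<lambda>c. csmult c A)"
    by (rule linearI) (simp_all add: csmult_add_left scaleR_csmult)
  then show ?thesis
    using linear_conv_bounded_linear by blast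
qed

lemma mpow_0 [simp]: "mpow A 0 = mat 1"
  by (simp add: mpow_def)

lemma mpow_Suc: "mpow A (Suc k) = A ** mpow A k"
  by (simp add: mpow_def)

lemma mpow_csmult: "mpow (csmult c (A::'n::finite cmat)) k = csmult (c ^ k) (mpow A k)"
  by (induction k) (simp_all add: mpow_Suc csmult_mult_csmult)

lemma mpow_involution:
  assumes "A ** A = (mat 1::'n::finite cmat)"
  shows "mpow A k = (if even k then mat 1 else A)"
  by (induction k) (simp_all add: mpow_Suc assms)

lemma mexp_csmult_involution:
  assumes "A ** A = (mat 1::'n::finite cmat)"
  shows "mexp (csmult c A) =
    csmult ((exp c + exp (- c)) / 2) (mat 1) + csmult ((exp c - exp (- c)) / 2) A"
proof -
  have term_split: "(1 / fact k) *\<^sub>R mpow (csmult c A) k =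
      csmult (((c ^ k + (- c) ^ k) / 2) /\<^sub>R fact k) (mat 1)
    + csmult (((c ^ k - (- c) ^ k) / 2) /\<^sub>R fact k) A" for k
    by (cases "even k")
      (simp_all add: mpow_csmult mpow_involution[OF assms] scaleR_csmult inverse_eq_divide)
  have even_part: "(\<lambda>k. ((c ^ k + (- c) ^ k) / 2) /\<^sub>R fact k) sums ((exp c + exp (- c)) / 2)"
    using sums_divide[OF sums_add[OF exp_converges[of c] exp_converges[of "- c"]], of 2]
    by (simp add: add_divide_distrib scaleR_conv_of_real distrib_left)
  have odd_part: "(\<lambda>k. ((c ^ k - (- c) ^ k) / 2) /\<^sub>R fact k) sums ((exp c - exp (- c)) / 2)"
    using sums_divide[OF sums_diff[OF exp_converges[of c] exp_converges[of "- c"]], of 2]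
    by (simp add: diff_divide_distrib scaleR_conv_of_real right_diff_distrib)
  have "(\<lambda>k. (1 / fact k) *\<^sub>R mpow (csmult c A) k) sums
      (csmult ((exp c + exp (- c)) / 2) (mat 1) + csmult ((exp c - exp (- c)) / 2) A)"
    unfolding term_split
    by (intro sums_add bounded_linear.sums[OF bounded_linear_csmult] even_part odd_part)
  then show ?thesis
    unfolding mexp_def by (rule sums_unique[symmetric])
qed

lemma matrix_vector_mult_csmult: "csmult c (A::'n::finite cmat) *v x = c *s (A *v x)"
  by (simp add: csmult_def matrix_vector_mult_def vec_eq_iff sum_distrib_left mult.assoc)

lemma matrix_vector_mult_scaleR_right:
  fixes A :: "'a::real_algebra_1^'n^'m"
  shows "A *v (r *\<^sub>R x) = r *\<^sub>R (A *v x)"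
  by (simp add: matrix_vector_mult_def vec_eq_iff scaleR_sum_right)

lemma matrix_vector_mult_cmult_right:
  fixes A :: "'a::comm_semiring_1^'n^'m"
  shows "A *v (c *s x) = c *s (A *v x)"
  by (simp add: matrix_vector_mult_def vec_eq_iff sum_distrib_left mult_ac)

lemma scaleR_matrix_vector_mult:
  fixes A :: "'a::real_algebra_1^'n^'m"
  shows "(r *\<^sub>R A) *v x = r *\<^sub>R (A *v x)"
  by (simp add: matrix_vector_mult_def vec_eq_iff scaleR_sum_right)

lemma funpow_linear_scaleR:
  fixes f :: "'a::real_vector \<Rightarrow> 'a"
  assumes "linear f"
  shows "(f ^^ k) (r *\<^sub>R x) = r *\<^sub>R (f ^^ k) x"
  using assms by (induction k) (simp_all add: linear_scale)

lemma inner_matrix_vector_cadj: "((A::'n::finite cmat) *v x) \<bullet> y = x \<bullet> (cadj A *v y)"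
proof -
  have inner_sum: "v \<bullet> w = (\<Sum>i\<in>UNIV. Re (v$i * cnj (w$i)))" for v w :: "complex^'n"
    by (simp add: inner_vec_def inner_complex_def)
  have "(A *v x) \<bullet> y = Re (\<Sum>i\<in>UNIV. \<Sum>j\<in>UNIV. A$i$j * x$j * cnj (y$i))"
    by (simp add: inner_sum matrix_vector_mult_def sum_distrib_right)
  also have "\<dots> = Re (\<Sum>j\<in>UNIV. \<Sum>i\<in>UNIV. A$i$j * x$j * cnj (y$i))"
    by (subst sum.swap) simp
  also have "\<dots> = x \<bullet> (cadj A *v y)"
    by (simp add: inner_sum matrix_vector_mult_def cadj_def sum_distrib_left mult_ac)
  finally show ?thesis .
qed

lemma unitary_cadj_mult_vector: "unitary U \<Longrightarrow> cadj U *v (U *v x) = x"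
  by (simp add: unitary_def matrix_vector_mul_assoc)

lemma unitary_mult_cadj_vector: "unitary U \<Longrightarrow> U *v (cadj U *v x) = x"
  by (simp add: unitary_def matrix_vector_mul_assoc)

lemma cadj_cadj [simp]: "cadj (cadj A) = A"
  by (simp add: cadj_def vec_eq_iff)

lemma unitary_cadj: "unitary U \<Longrightarrow> unitary (cadj U)"
  by (simp add: unitary_def)

lemma norm_unitary:
  assumes "unitary U"
  shows "norm (U *v x) = norm x"
proof -
  have "(norm (U *v x))\<^sup>2 = (norm x)\<^sup>2"
    using inner_matrix_vector_cadj[of U x "U *v x"] unitary_cadj_mult_vector[OF assms]
    by (simp add: power2_norm_eq_inner)
  then show ?thesis
    by (simp add: power2_eq_iff_nonneg)
qed

lemma norm_unitary_cadj: "unitary U \<Longrightarrow> norm (cadj U *v x) = norm x"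
  using norm_unitary unitary_cadj by blast

lemma orth_proj_idem_vector: "orth_proj P \<Longrightarrow> P *v (P *v x) = P *v x"
  by (simp add: orth_proj_def matrix_vector_mul_assoc)

lemma orth_proj_inner: "orth_proj P \<Longrightarrow> (P *v x) \<bullet> y = x \<bullet> (P *v y)"
  using inner_matrix_vector_cadj[of P x y] by (simp add: orth_proj_def)

lemma orth_proj_norm_le:
  assumes "orth_proj P"
  shows "norm (P *v x) \<le> norm x"
proof -
  have "(norm (P *v x))\<^sup>2 = x \<bullet> (P *v x)"
    using orth_proj_inner[OF assms, of x "P *v x"] orth_proj_idem_vector[OF assms]
    by (simp add: power2_norm_eq_inner)
  also have "\<dots> \<le> norm x * norm (P *v x)"
    by (rule norm_cauchy_schwarz)
  finally show ?thesis
    by (cases "P *v x = 0") (auto simp: power2_eq_square)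
qed

lemma img_orth_proj_iff: "orth_proj P \<Longrightarrow> v \<in> img P \<longleftrightarrow> P *v v = v"
  unfolding img_def by (metis orth_proj_idem_vector rangeE rangeI)

lemma subspace_img: "subspace (img (A::'n::finite cmat))"
  unfolding img_def by (rule linear_subspace_image[OF matrix_vector_mul_linear subspace_UNIV])

definition reflection :: "'n::finite cmat \<Rightarrow> 'n cmat" where
  "reflection P = 2 *\<^sub>R P - mat 1"

lemma reflection_matrix_vector_mult: "reflection P *v x = 2 *\<^sub>R (P *v x) - x"
  by (simp add: reflection_def matrix_vector_mult_diff_rdistrib scaleR_matrix_vector_mult)

lemma reflection_fixed: "P *v x = x \<Longrightarrow> reflection P *v x = x"
  by (simp add: reflection_matrix_vector_mult scaleR_2)

lemma reflection_involution:
  assumes "orth_proj P"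
  shows "reflection P ** reflection P = mat 1"
  unfolding matrix_eq
  using orth_proj_idem_vector[OF assms]
  by (simp add: matrix_vector_mul_assoc[symmetric] reflection_matrix_vector_mult matrix_vector_mult_diff_distrib
      matrix_vector_mult_scaleR_right scaleR_diff_right)

lemma unitary_reflection:
  assumes "orth_proj P"
  shows "unitary (reflection P)"
proof -
  have "cadj (reflection P) = reflection P"
    using assms by (simp add: orth_proj_def reflection_def cadj_def mat_def vec_eq_iff)
  then show ?thesis
    using reflection_involution[OF assms] by (simp add: unitary_def)
qed

lemma refl_phase_eq:
  assumes "orth_proj P"
  shows "refl_phase \<phi> P = csmult (cos \<phi>) (mat 1) + csmult (\<i> * sin \<phi>) (reflection P)"
proof -
  have "(exp (\<i> * of_real \<phi>) + exp (- (\<i> * of_real \<phi>))) / 2 = cos \<phi>"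
    by (simp add: cos_exp_eq[symmetric] cos_of_real)
  moreover have "(exp (\<i> * of_real \<phi>) - exp (- (\<i> * of_real \<phi>))) / 2 = \<i> * sin \<phi>"
    using sin_exp_eq[of "of_real \<phi>"] by (simp add: field_simps sin_of_real)
  ultimately show ?thesis
    using mexp_csmult_involution[OF reflection_involution[OF assms]]
    by (simp add: refl_phase_def reflection_def)
qed

definition grover_iterate :: "'n::finite cmat \<Rightarrow> 'n cmat \<Rightarrow> 'n cmat \<Rightarrow> 'n cmat" where
  "grover_iterate Pt P U = refl_phase (pi / 2) P ** cadj U ** refl_phase (pi / 2) Pt ** U"

lemma grover_iterate_matrix_vector_mult:
  assumes "orth_proj Pt" and "orth_proj P"
  shows "grover_iterate Pt P U *v x = - (reflection P *v (cadj U *v (reflection Pt *v (U *v x))))"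
proof -
  have "grover_iterate Pt P U *v x =
      (\<i> * \<i>) *s (reflection P *v (cadj U *v (reflection Pt *v (U *v x))))"
    by (simp add: grover_iterate_def refl_phase_eq[OF assms(1)] refl_phase_eq[OF assms(2)]
        matrix_vector_mul_assoc[symmetric] matrix_vector_mult_csmult
        matrix_vector_mult_cmult_right vector_smult_assoc)
  then show ?thesis
    by (simp add: vec_eq_iff)
qed

lemma norm_grover_iterate:
  assumes "orth_proj Pt" and "orth_proj P" and "unitary U"
  shows "norm (grover_iterate Pt P U *v x) = norm x"
  using assms
  by (simp add: grover_iterate_matrix_vector_mult norm_unitary norm_unitary_cadj unitary_reflection)

lemma Uphi_aux_grover:
  assumes "orth_proj Pt" and "orth_proj P"
  shows "Uphi_aux Pt P U (\<lambda>j. if j = 1 then 0 else pi / 2) m *v x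
    = U *v (((*v) (grover_iterate Pt P U)) ^^ m) x"
proof (induction m arbitrary: x)
  case 0
  then show ?case
    using assms(1) by (simp add: refl_phase_eq reflection_def)
next
  case (Suc m)
  have "Uphi_aux Pt P U (\<lambda>j. if j = 1 then 0 else pi / 2) (Suc m) =
      Uphi_aux Pt P U (\<lambda>j. if j = 1 then 0 else pi / 2) m ** grover_iterate Pt P U"
    by (simp add: grover_iterate_def)
  then show ?case
    using Suc by (simp add: matrix_vector_mul_assoc[symmetric] funpow_swap1)
qed

text \<open>These identities hold for every \<open>s\<close>; for \<open>s = sin \<theta>\<close> the remainder terms are the two
  errors that the hypothesis and its adjoint form make small.\<close>
lemma grover_iterate_start:
  assumes "orth_proj Pt" and "orth_proj P" and "unitary U" and "P *v \<psi> = \<psi>"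
  shows "grover_iterate Pt P U *v \<psi> = (1 - 4 * s\<^sup>2) *\<^sub>R \<psi> + (2 * s) *\<^sub>R y
    - 2 *\<^sub>R (reflection P *v (cadj U *v (Pt *v (U *v \<psi>)) - s *\<^sub>R y))
    - (4 * s) *\<^sub>R (P *v y - s *\<^sub>R \<psi>)"
proof -
  have "grover_iterate Pt P U *v \<psi> = \<psi> - 2 *\<^sub>R (reflection P *v (cadj U *v (Pt *v (U *v \<psi>))))"
    using assms
    by (simp add: grover_iterate_matrix_vector_mult reflection_matrix_vector_mult[of Pt] reflection_fixed matrix_vector_mult_diff_distrib
        matrix_vector_mult_scaleR_right unitary_cadj_mult_vector algebra_simps)
  then show ?thesis
    by (simp add: reflection_matrix_vector_mult matrix_vector_mult_diff_distrib matrix_vector_mult_scaleR_right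
        algebra_simps power2_eq_square)
qed

lemma grover_iterate_target:
  assumes "orth_proj Pt" and "orth_proj P" and "unitary U" and "Pt *v (U *v y) = U *v y"
  shows "grover_iterate Pt P U *v y = y - (2 * s) *\<^sub>R \<psi> - 2 *\<^sub>R (P *v y - s *\<^sub>R \<psi>)"
proof -
  have "grover_iterate Pt P U *v y = - (reflection P *v y)"
    using assms by (simp add: grover_iterate_matrix_vector_mult reflection_fixed unitary_cadj_mult_vector)
  then show ?thesis
    by (simp add: reflection_matrix_vector_mult algebra_simps)
qed

lemma grover_step_error:
  assumes "orth_proj Pt" and "orth_proj P" and "unitary U"
    and "P *v \<psi> = \<psi>" and "Pt *v (U *v y) = U *v y"
    and err_U: "norm (Pt *v (U *v \<psi>) - s *\<^sub>R (U *v y)) \<le> \<delta>"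
    and err_P: "norm (P *v y - s *\<^sub>R \<psi>) \<le> \<delta>"
  shows "norm (grover_iterate Pt P U *v (\<alpha> *\<^sub>R \<psi> + \<beta> *\<^sub>R y)
      - (((1 - 4 * s\<^sup>2) * \<alpha> - 2 * s * \<beta>) *\<^sub>R \<psi> + (2 * s * \<alpha> + \<beta>) *\<^sub>R y))
    \<le> (2 * \<bar>\<alpha>\<bar> + \<bar>4 * s * \<alpha> + 2 * \<beta>\<bar>) * \<delta>"
proof -
  define d\<^sub>U where "d\<^sub>U = cadj U *v (Pt *v (U *v \<psi>)) - s *\<^sub>R y"
  define d\<^sub>P where "d\<^sub>P = P *v y - s *\<^sub>R \<psi>"
  have "grover_iterate Pt P U *v (\<alpha> *\<^sub>R \<psi> + \<beta> *\<^sub>R y)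
      - (((1 - 4 * s\<^sup>2) * \<alpha> - 2 * s * \<beta>) *\<^sub>R \<psi> + (2 * s * \<alpha> + \<beta>) *\<^sub>R y)
    = - (2 * \<alpha>) *\<^sub>R (reflection P *v d\<^sub>U) - (4 * s * \<alpha> + 2 * \<beta>) *\<^sub>R d\<^sub>P"
    by (simp add: matrix_vector_right_distrib matrix_vector_mult_scaleR_right d\<^sub>U_def d\<^sub>P_def
        grover_iterate_start[OF assms(1-4), where s = s and y = y]
        grover_iterate_target[OF assms(1-3,5), where s = s and \<psi> = \<psi>]
        algebra_simps power2_eq_square)
  also have "norm \<dots> \<le> \<bar>2 * \<alpha>\<bar> * norm d\<^sub>U + \<bar>4 * s * \<alpha> + 2 * \<beta>\<bar> * norm d\<^sub>P"
    using norm_triangle_ineq4[of "(- (2 * \<alpha>)) *\<^sub>R (reflection P *v d\<^sub>U)"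
        "(4 * s * \<alpha> + 2 * \<beta>) *\<^sub>R d\<^sub>P"] assms(2)
    by (simp add: norm_unitary unitary_reflection)
  also have "\<dots> \<le> \<bar>2 * \<alpha>\<bar> * \<delta> + \<bar>4 * s * \<alpha> + 2 * \<beta>\<bar> * \<delta>"
  proof -
    have "d\<^sub>U = cadj U *v (Pt *v (U *v \<psi>) - s *\<^sub>R (U *v y))"
      using assms(3) by (simp add: d\<^sub>U_def matrix_vector_mult_diff_distrib
          matrix_vector_mult_scaleR_right unitary_cadj_mult_vector)
    then have "norm d\<^sub>U \<le> \<delta>"
      using err_U assms(3) by (simp add: norm_unitary_cadj)
    then show ?thesis
      using err_P by (intro add_mono mult_left_mono) (auto simp: d\<^sub>P_def)
  qed
  finally show ?thesis
    by (simp add: abs_mult algebra_simps)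
qed

lemma cos_add_double_recurrence:
  fixes u t :: real
  shows "cos (u + 2 * t) = (1 - 4 * (sin t)\<^sup>2) * cos u - 2 * sin t * sin (u - t)"
proof -
  have "cos (u + 2 * t) = cos u * (1 - 2 * (sin t)\<^sup>2) - sin u * (2 * sin t * cos t)"
    by (simp add: cos_add cos_double_sin sin_double)
  then show ?thesis
    by (simp add: sin_diff algebra_simps power2_eq_square)
qed

lemma sin_add_recurrence:
  fixes u t :: real
  shows "sin (u + t) = 2 * sin t * cos u + sin (u - t)"
  by (simp add: sin_add sin_diff algebra_simps)

text \<open>The left side is \<open>2 |cos u| + 2 |sin (u + t)|\<close>, by Cauchy-Schwarz at most
  \<open>2 \<surd>(2 + 2 sin t)\<close>, and this is at most \<open>4 cos t\<close> exactly when \<open>sin t \<le> 1/2\<close>.\<close>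
lemma grover_coefficient_bound:
  fixes u t :: real
  assumes "cos t > 0" and "0 \<le> sin t" and "sin t \<le> 1 / 2"
  shows "2 * \<bar>cos u\<bar> + \<bar>4 * sin t * cos u + 2 * sin (u - t)\<bar> \<le> 4 * cos t"
proof -
  define X Y s c where "X = \<bar>cos u\<bar>" and "Y = \<bar>sin u\<bar>" and "s = sin t" and "c = cos t"
  have "4 * sin t * cos u + 2 * sin (u - t) = 2 * (cos u * s + sin u * c)"
    by (simp add: sin_diff s_def c_def algebra_simps)
  moreover have "\<bar>cos u * s + sin u * c\<bar> \<le> X * s + Y * c"
    using assms unfolding X_def Y_def s_def c_def
    by (metis abs_mult abs_of_nonneg abs_triangle_ineq less_imp_le)
  ultimately have "2 * \<bar>cos u\<bar> + \<bar>4 * sin t * cos u + 2 * sin (u - t)\<bar> \<le> 2 * (X * (1 + s) + Y * c)"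
    by (simp add: X_def algebra_simps)
  moreover have "X * (1 + s) + Y * c \<le> 2 * c"
  proof (rule power2_le_imp_le)
    have "(X * (1 + s) + Y * c)\<^sup>2 \<le> (X\<^sup>2 + Y\<^sup>2) * ((1 + s)\<^sup>2 + c\<^sup>2)"
      using zero_le_power2[of "X * c - Y * (1 + s)"] by (simp add: power2_eq_square algebra_simps)
    also have "\<dots> = 2 + 2 * s"
      by (simp add: X_def Y_def s_def c_def power2_eq_square algebra_simps)
    also have "\<dots> \<le> 4 - 4 * s\<^sup>2"
      using mult_nonpos_nonneg[of "2 * s - 1" "2 * s + 2"] assms(2,3)
      by (simp add: s_def power2_eq_square algebra_simps)
    also have "\<dots> = (2 * c)\<^sup>2"
      by (simp add: s_def c_def cos_squared_eq)
    finally show "(X * (1 + s) + Y * c)\<^sup>2 \<le> (2 * c)\<^sup>2" .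
    show "0 \<le> 2 * c"
      using assms(1) by (simp add: c_def)
  qed
  ultimately show ?thesis
    by (simp add: c_def)
qed

lemma dist_funpow_tracking:
  fixes f :: "'a::metric_space \<Rightarrow> 'a"
  assumes nonexpansive: "\<And>x y. dist (f x) (f y) \<le> dist x y"
    and step: "\<And>j. dist (f (z j)) (z (Suc j)) \<le> \<delta>"
  shows "dist ((f ^^ j) (z 0)) (z j) \<le> real j * \<delta>"
proof (induction j)
  case (Suc j)
  have "dist ((f ^^ Suc j) (z 0)) (z (Suc j))
      \<le> dist (f ((f ^^ j) (z 0))) (f (z j)) + dist (f (z j)) (z (Suc j))"
    by (simp add: dist_triangle)
  also have "\<dots> \<le> real j * \<delta> + \<delta>"
    using nonexpansive Suc step by (intro add_mono) (blast intro: order_trans)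
  finally show ?case
    by (simp add: algebra_simps)
qed simp

text \<open>\<open>z j\<close> is \<open>cos \<theta>\<close> times the exact orbit of \<open>\<psi>\<close>, which rotates by \<open>2\<theta>\<close> in the plane
  of \<open>\<psi>\<close> and \<open>y\<close> and reaches \<open>y\<close> after \<open>k\<close> steps.\<close>
lemma grover_orbit:
  assumes "orth_proj Pt" and "orth_proj P" and "unitary U"
    and "P *v \<psi> = \<psi>" and "Pt *v (U *v y) = U *v y"
    and "norm (Pt *v (U *v \<psi>) - sin \<theta> *\<^sub>R (U *v y)) \<le> \<delta>"
    and "norm (P *v y - sin \<theta> *\<^sub>R \<psi>) \<le> \<delta>"
    and "0 < \<theta>" and "\<theta> \<le> pi / 6" and "(2 * real k + 1) * \<theta> = pi / 2"
  shows "norm ((((*v) (grover_iterate Pt P U)) ^^ k) \<psi> - y) \<le> 4 * real k * \<delta>"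
proof -
  let ?G = "(*v) (grover_iterate Pt P U)"
  define z where "z j = cos ((2 * real j + 1) * \<theta>) *\<^sub>R \<psi> + sin (2 * real j * \<theta>) *\<^sub>R y" for j
  have cos_pos: "cos \<theta> > 0"
    using assms(8,9) by (intro cos_gt_zero_pi) auto
  have sin_bounds: "0 \<le> sin \<theta>" "sin \<theta> \<le> 1 / 2"
    using assms(8,9) sin_monotone_2pi_le[of \<theta> "pi / 6"] by (auto simp: sin_30 intro: sin_ge_zero)
  have "\<delta> \<ge> 0"
    using assms(7) norm_ge_zero order_trans by blast
  have step: "dist (?G (z j)) (z (Suc j)) \<le> 4 * cos \<theta> * \<delta>" for j
  proof -
    define u where "u = (2 * real j + 1) * \<theta>"
    have "z j = cos u *\<^sub>R \<psi> + sin (u - \<theta>) *\<^sub>R y"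
      by (simp add: z_def u_def algebra_simps)
    moreover have "z (Suc j) = ((1 - 4 * (sin \<theta>)\<^sup>2) * cos u - 2 * sin \<theta> * sin (u - \<theta>)) *\<^sub>R \<psi>
        + (2 * sin \<theta> * cos u + sin (u - \<theta>)) *\<^sub>R y"
      unfolding cos_add_double_recurrence[symmetric] sin_add_recurrence[symmetric]
      by (simp add: z_def u_def algebra_simps)
    ultimately have "dist (?G (z j)) (z (Suc j))
        \<le> (2 * \<bar>cos u\<bar> + \<bar>4 * sin \<theta> * cos u + 2 * sin (u - \<theta>)\<bar>) * \<delta>"
      using grover_step_error[OF assms(1-7)] by (simp add: dist_norm)
    also have "\<dots> \<le> 4 * cos \<theta> * \<delta>"
      using grover_coefficient_bound[OF cos_pos sin_bounds] \<open>\<delta> \<ge> 0\<close> by (rule mult_right_mono)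
    finally show ?thesis .
  qed
  have nonexpansive: "dist (?G x) (?G x') \<le> dist x x'" for x x'
    using norm_grover_iterate[OF assms(1-3)]
    by (simp add: dist_norm matrix_vector_mult_diff_distrib[symmetric])
  have end_angles: "(2 * real k + 1) * \<theta> = pi / 2" "2 * real k * \<theta> = pi / 2 - \<theta>"
    using assms(10) by (simp_all add: algebra_simps)
  have "z 0 = cos \<theta> *\<^sub>R \<psi>" and "z k = cos \<theta> *\<^sub>R y"
    unfolding z_def end_angles by (simp_all add: sin_cos_eq)
  then have "dist (cos \<theta> *\<^sub>R (?G ^^ k) \<psi>) (cos \<theta> *\<^sub>R y) \<le> real k * (4 * cos \<theta> * \<delta>)"
    using dist_funpow_tracking[of ?G z, OF nonexpansive step, of k]
    by (simp add: funpow_linear_scaleR[OF matrix_vector_mul_linear])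
  then show ?thesis
    using cos_pos by (simp add: dist_norm scaleR_diff_right[symmetric] mult_ac)
qed

lemma norm_le_of_unit_norm_le:
  fixes f :: "'a::real_normed_vector \<Rightarrow> 'b::real_normed_vector"
  assumes "subspace S" and homogeneous: "\<And>r v. f (r *\<^sub>R v) = r *\<^sub>R f v"
    and unit_bound: "\<forall>v\<in>S. norm v = 1 \<longrightarrow> norm (f v) \<le> \<epsilon>" and "v \<in> S"
  shows "norm (f v) \<le> \<epsilon> * norm v"
proof (cases "v = 0")
  case True
  then show ?thesis
    using homogeneous[of 0 v] by simp
next
  case False
  have "norm (f ((1 / norm v) *\<^sub>R v)) \<le> \<epsilon>"
    using unit_bound subspace_scale[OF assms(1,4)] False by simp
  then show ?thesis
    using False by (simp add: homogeneous field_simps)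
qed

lemma inner_isometry_on_subspace:
  fixes f :: "'a::real_inner \<Rightarrow> 'b::real_inner"
  assumes "subspace S" and "linear f" and isometry: "\<forall>v\<in>S. norm (f v) = norm v"
    and "v \<in> S" and "w \<in> S"
  shows "f v \<bullet> f w = v \<bullet> w"
proof -
  have "f v \<bullet> f w = ((norm (f (v + w)))\<^sup>2 - (norm (f v))\<^sup>2 - (norm (f w))\<^sup>2) / 2"
    using assms(2) by (simp add: dot_norm linear_add)
  also have "\<dots> = v \<bullet> w"
    using isometry assms(4,5) subspace_add[OF assms(1,4,5)] by (simp add: dot_norm)
  finally show ?thesis .
qed

lemma adjoint_approximation:
  assumes "orth_proj Pt" and "orth_proj P" and "unitary U"
    and W_maps: "\<forall>\<psi>\<in>img P. W *v \<psi> \<in> img Pt"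
    and W_isom: "\<forall>\<psi>\<in>img P. norm (W *v \<psi>) = norm \<psi>"
    and approx: "\<forall>v\<in>img P. norm (s *\<^sub>R (W *v v) - Pt *v (U *v v)) \<le> \<epsilon> * norm v"
    and "\<psi> \<in> img P"
  shows "norm (P *v (cadj U *v (W *v \<psi>)) - s *\<^sub>R \<psi>) \<le> \<epsilon> * norm \<psi>"
proof -
  define v where "v = P *v (cadj U *v (W *v \<psi>)) - s *\<^sub>R \<psi>"
  have "P *v \<psi> = \<psi>" and "Pt *v (W *v \<psi>) = W *v \<psi>"
    using assms(1,2,7) W_maps by (simp_all add: img_orth_proj_iff)
  then have "P *v v = v"
    using assms(2) by (simp add: v_def matrix_vector_mult_diff_distrib
        matrix_vector_mult_scaleR_right orth_proj_idem_vector)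
  then have "v \<in> img P"
    using assms(2) by (simp add: img_orth_proj_iff)
  have "v \<bullet> (P *v (cadj U *v (W *v \<psi>))) = (Pt *v (U *v v)) \<bullet> (W *v \<psi>)"
    using orth_proj_inner[OF assms(2), of v] orth_proj_inner[OF assms(1), of "U *v v"]
      \<open>P *v v = v\<close> \<open>Pt *v (W *v \<psi>) = W *v \<psi>\<close> inner_matrix_vector_cadj[of U v] by simp
  moreover have "v \<bullet> \<psi> = (W *v v) \<bullet> (W *v \<psi>)"
    using inner_isometry_on_subspace[OF subspace_img matrix_vector_mul_linear W_isom]
      \<open>v \<in> img P\<close> assms(7) by simp
  ultimately have "v \<bullet> v = (Pt *v (U *v v) - s *\<^sub>R (W *v v)) \<bullet> (W *v \<psi>)"
    by (simp add: v_def inner_diff_right inner_diff_left)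
  also have "\<dots> \<le> norm (s *\<^sub>R (W *v v) - Pt *v (U *v v)) * norm (W *v \<psi>)"
    using norm_cauchy_schwarz by (metis norm_minus_commute)
  also have "\<dots> \<le> \<epsilon> * norm v * norm \<psi>"
    using approx W_isom \<open>v \<in> img P\<close> assms(7) by (simp add: mult_right_mono)
  finally have "norm v * norm v \<le> (\<epsilon> * norm \<psi>) * norm v"
    by (simp add: norm_eq_sqrt_inner mult_ac)
  moreover have "0 \<le> \<epsilon> * norm \<psi>"
    using approx assms(7) norm_ge_zero order_trans by blast
  ultimately show ?thesis
    by (cases "v = 0") (auto simp: v_def)
qed

lemma grover_amplification:
  assumes "orth_proj Pt" and "orth_proj P" and "unitary U"
    and W_maps: "\<forall>\<psi>\<in>img P. W *v \<psi> \<in> img Pt"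
    and W_isom: "\<forall>\<psi>\<in>img P. norm (W *v \<psi>) = norm \<psi>"
    and approx: "\<forall>v\<in>img P. norm (sin \<theta> *\<^sub>R (W *v v) - Pt *v (U *v v)) \<le> \<epsilon> * norm v"
    and "0 < \<theta>" and "\<theta> \<le> pi / 6" and "(2 * real k + 1) * \<theta> = pi / 2" and "\<psi> \<in> img P"
  shows "norm (W *v \<psi> - Pt *v (U *v (((*v) (grover_iterate Pt P U)) ^^ k) \<psi>))
    \<le> 4 * real k * (\<epsilon> * norm \<psi>)"
proof -
  define y where "y = cadj U *v (W *v \<psi>)"
  define x where "x = (((*v) (grover_iterate Pt P U)) ^^ k) \<psi>"
  have Uy: "U *v y = W *v \<psi>"
    using assms(3) by (simp add: y_def unitary_mult_cadj_vector)
  have "Pt *v (U *v y) = U *v y"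
    using Uy W_maps assms(1,10) by (simp add: img_orth_proj_iff)
  moreover have "norm (Pt *v (U *v \<psi>) - sin \<theta> *\<^sub>R (U *v y)) \<le> \<epsilon> * norm \<psi>"
    using approx assms(10) by (simp add: Uy norm_minus_commute)
  moreover have "norm (P *v y - sin \<theta> *\<^sub>R \<psi>) \<le> \<epsilon> * norm \<psi>"
    unfolding y_def by (rule adjoint_approximation[OF assms(1-6,10)])
  ultimately have "norm (x - y) \<le> 4 * real k * (\<epsilon> * norm \<psi>)"
    unfolding x_def using assms(2,10)
    by (intro grover_orbit[OF assms(1-3) _ _ _ _ assms(7-9)]) (simp_all add: img_orth_proj_iff)
  moreover have "W *v \<psi> - Pt *v (U *v x) = Pt *v (U *v (y - x))"
    using \<open>Pt *v (U *v y) = U *v y\<close> Uy by (simp add: matrix_vector_mult_diff_distrib)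
  moreover have "norm (Pt *v (U *v (y - x))) \<le> norm (x - y)"
    using orth_proj_norm_le[OF assms(1)] norm_unitary[OF assms(3)] by (metis norm_minus_commute)
  ultimately show ?thesis
    by (simp add: x_def)
qed

theorem mainTheorem13:
  fixes n :: nat and \<epsilon> :: real
    and U Pt P W :: "'n::finite cmat"
  assumes "odd n" and "\<epsilon> \<ge> 0"
    and "unitary U" and "orth_proj Pt" and "orth_proj P"
    and W_maps: "\<forall>\<psi>\<in>img P. W *v \<psi> \<in> img Pt"
    and W_isom: "\<forall>\<psi>\<in>img P. norm (W *v \<psi>) = norm \<psi>"
    and hyp: "\<forall>\<psi>\<in>img P. norm \<psi> = 1 \<longrightarrow>
               norm (sin (pi / (2 * real n)) *\<^sub>R (W *v \<psi>) - Pt *v (U *v \<psi>)) \<le> \<epsilon>"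
  shows "\<exists>(\<phi>::nat \<Rightarrow> real) (s::complex). s \<in> {1, -1} \<and>
           (\<forall>\<psi>\<in>img P. norm \<psi> = 1 \<longrightarrow>
              norm (W *v \<psi> - Pt *v (csmult s (Uphi Pt P U n \<phi>) *v \<psi>)) \<le> 2 * real n * \<epsilon>)"
proof -
  obtain k where n: "n = 2 * k + 1"
    using \<open>odd n\<close> oddE by blast
  define \<phi> :: "nat \<Rightarrow> real" where "\<phi> = (\<lambda>j. if j = 1 then 0 else pi / 2)"
  define \<theta> where "\<theta> = pi / (2 * real n)"
  let ?G = "(*v) (grover_iterate Pt P U)"
  have Uphi: "Uphi Pt P U n \<phi> *v x = U *v (?G ^^ k) x" for x
    unfolding Uphi_def \<phi>_def using Uphi_aux_grover[OF assms(4,5)] n by simp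
  have approx: "\<forall>v\<in>img P. norm (sin \<theta> *\<^sub>R (W *v v) - Pt *v (U *v v)) \<le> \<epsilon> * norm v"
    using norm_le_of_unit_norm_le[OF subspace_img _ hyp[folded \<theta>_def]]
    by (simp add: matrix_vector_mult_scaleR_right scaleR_diff_right)
  have "norm (W *v \<psi> - Pt *v (U *v (?G ^^ k) \<psi>)) \<le> 2 * real n * \<epsilon>"
    if "\<psi> \<in> img P" and "norm \<psi> = 1" for \<psi>
  proof (cases "k = 0")
    case True
    then show ?thesis
      using bspec[OF approx that(1)] that(2) \<open>\<epsilon> \<ge> 0\<close> by (simp add: \<theta>_def n)
  next
    case False
    then have angle: "0 < \<theta>" "\<theta> \<le> pi / 6" "(2 * real k + 1) * \<theta> = pi / 2"
      by (simp_all add: \<theta>_def n field_simps)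
    have "norm (W *v \<psi> - Pt *v (U *v (?G ^^ k) \<psi>)) \<le> 4 * real k * \<epsilon>"
      using grover_amplification[OF assms(4,5,3) W_maps W_isom approx angle that(1)] that(2)
      by simp
    also have "\<dots> \<le> 2 * real n * \<epsilon>"
      using \<open>\<epsilon> \<ge> 0\<close> by (simp add: n mult_right_mono)
    finally show ?thesis .
  qed
  then show ?thesis
    by (intro exI[of _ \<phi>] exI[of _ 1]) (simp add: Uphi)
qed

end
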